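(* For all integers $k,l\ge 2$, $\mathcal{I}_{k+l-1}\subseteq\mathcal{I}_k\circ\mathcal{I}_l$.
   Context: A permutation of order $n$ is a bijection $\pi:[n]\to[n]$, where $[n]=\{1,\dots,n\}$, also viewed as the sequence $\pi(1),\dots,\pi(n)$. For permutations of the same order, $(\pi\circ\sigma)(i)=\pi(\sigma(i))$. For sets of permutations, $\mathcal{A}\circ\mathcal{B}=\{\pi\circ\varphi : \pi\in\mathcal{A},\varphi\in\mathcal{B},|\pi|=|\varphi|\}$, where $|\pi|$ is the order of $\pi$. $\mathcal{I}_k$ is the class of all permutations whose sequence can be partitioned into at most $k$ increasing subsequences (equivalently, those containing no decreasing subsequence of length $k+1$). *)

theory Defs
  imports "HOL-Combinatorics.Combinatorics" "HOL-Library.Disjoint_Sets"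
begin

text \<open>A permutation \<open>p\<close> of order \<open>n\<close> is represented by the pair \<open>(n, p)\<close>, where the
  bijection of \<open>{1..n}\<close> is extended by the identity outside \<open>{1..n}\<close> (as \<open>permutes\<close> requires).
  Keeping the order explicit matters: the same function on \<open>nat\<close> represents permutations of
  several orders, which are different objects. The empty permutation (\<open>n = 0\<close>) is allowed.\<close>

type_synonym perm_seq = "nat \<times> (nat \<Rightarrow> nat)"

definition permutations :: "perm_seq set" where
  "permutations = {(n, p). p permutes {1..n}}"

text \<open>A subsequence is given by its set of positions; partition blocks are nonempty, and
  for order \<open>0\<close> the only partition is the empty one.\<close>

definition increasing_class :: "nat \<Rightarrow> perm_seq set" where
  "increasing_class k =
     {(n, p) \<in> permutations.
        \<exists>P. partition_on {1..n} P \<and> card P \<le> k \<and> (\<forall>S\<in>P. strict_mono_on S p)}"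

definition class_comp :: "perm_seq set \<Rightarrow> perm_seq set \<Rightarrow> perm_seq set" where
  "class_comp A B = {(n, p \<circ> q) | n p q. (n, p) \<in> A \<and> (n, q) \<in> B}"

end

theory Submission
  imports Defs
begin

text \<open>Split the \<open>k + l - 1\<close> increasing subsequences of \<open>p\<close> into one distinguished
  subsequence \<open>A\<close>, further \<open>k - 1\<close> with union \<open>D\<close>, and \<open>l - 1\<close> with union \<open>E\<close>. The order by
  position on \<open>A \<union> D\<close> and the order by value on \<open>A \<union> E\<close> agree on \<open>A\<close>, so they have a common
  linear extension. Let \<open>q\<close> send each position to its rank in this extension. Then \<open>q\<close> increases
  on \<open>A \<union> D\<close> and on each subsequence of \<open>E\<close>, while \<open>p \<circ> q\<inverse>\<close> increases on the images of
  \<open>A \<union> E\<close> and of each subsequence of \<open>D\<close>.\<close>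

lemma increasing_class_iff_coloring:
  "(n, p) \<in> increasing_class k \<longleftrightarrow>
     p permutes {1..n} \<and>
     (\<exists>c. c ` {1..n} \<subseteq> {..<k} \<and>
        (\<forall>x\<in>{1..n}. \<forall>y\<in>{1..n}. c x = c y \<longrightarrow> x < y \<longrightarrow> p x < p y))"
  (is "_ \<longleftrightarrow> _ \<and> (\<exists>c. ?col c)")
proof -
  have "(\<exists>P. partition_on {1..n} P \<and> card P \<le> k \<and> (\<forall>S\<in>P. strict_mono_on S p))
    \<longleftrightarrow> (\<exists>c. ?col c)" (is "?partition \<longleftrightarrow> ?coloring")
  proof
    assume ?partition
    then obtain P where P: "partition_on {1..n} P" "card P \<le> k" "\<forall>S\<in>P. strict_mono_on S p"
      by blast
    have "finite P"
      using P(1) by (meson finite_atLeastAtMost finite_elements)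
    then obtain h where h: "bij_betw h P {0..<card P}"
      using ex_bij_betw_finite_nat by blast
    have "\<forall>x\<in>{1..n}. \<exists>S. S \<in> P \<and> x \<in> S"
      using P(1) unfolding partition_on_def by blast
    then obtain b where b: "\<And>x. x \<in> {1..n} \<Longrightarrow> b x \<in> P \<and> x \<in> b x"
      by metis
    have "h (b x) < k" if "x \<in> {1..n}" for x
      using bij_betwE[OF h] b[OF that] P(2) by fastforce
    moreover have "p x < p y"
      if "x \<in> {1..n}" "y \<in> {1..n}" "h (b x) = h (b y)" "x < y" for x y
    proof -
      have "b x = b y"
        using that b h by (metis bij_betw_imp_inj_on inj_onD)
      then show ?thesis
        using that b P(3) by (metis strict_mono_onD)
    qed
    ultimately have "?col (h \<circ> b)"
      by auto
    then show ?coloring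
      by (rule exI[of _ "h \<circ> b"])
  next
    assume ?coloring
    then obtain c where c: "?col c" ..
    define P where "P = (\<lambda>i. {x\<in>{1..n}. c x = i}) ` (c ` {1..n})"
    have "partition_on {1..n} P"
      unfolding P_def by (rule partition_onI) (auto simp: disjnt_def)
    moreover have "card P \<le> k"
    proof -
      have "card P \<le> card (c ` {1..n})"
        unfolding P_def by (intro card_image_le) simp
      also have "\<dots> \<le> card {..<k}"
        using c by (intro card_mono) auto
      finally show ?thesis by simp
    qed
    moreover have "\<forall>S\<in>P. strict_mono_on S p"
      unfolding P_def using c by (auto intro!: strict_mono_onI)
    ultimately show ?partition by blast
  qed
  then show ?thesis
    by (simp only: increasing_class_def permutations_def mem_Collect_eq case_prod_conv)
qed

text \<open>A linear order of the positions can thus be given by any injective key; replacing keys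
  by their ranks makes it a permutation.\<close>

lemma rank_permutation:
  fixes key :: "nat \<Rightarrow> 'a::linorder"
  assumes inj: "inj_on key {1..n}"
  obtains q where "q permutes {1..n}"
    and "\<And>x y. x \<in> {1..n} \<Longrightarrow> y \<in> {1..n} \<Longrightarrow> key x < key y \<Longrightarrow> q x < q y"
proof
  \<comment> \<open>Counting \<open>x\<close> itself makes the ranks start at 1.\<close>
  define r where "r x = card {z\<in>{1..n}. key z \<le> key x}" for x
  define q where "q x = (if x \<in> {1..n} then r x else x)" for x
  have r: "r x < r y" if "y \<in> {1..n}" "key x < key y" for x y
  proof -
    have "{z\<in>{1..n}. key z \<le> key x} \<subseteq> {z\<in>{1..n}. key z \<le> key y}"
      using that by auto
    moreover have "y \<in> {z\<in>{1..n}. key z \<le> key y} - {z\<in>{1..n}. key z \<le> key x}"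
      using that by auto
    ultimately have "{z\<in>{1..n}. key z \<le> key x} \<subset> {z\<in>{1..n}. key z \<le> key y}"
      by blast
    then show ?thesis
      unfolding r_def by (intro psubset_card_mono) simp_all
  qed
  show mono: "q x < q y" if "x \<in> {1..n}" "y \<in> {1..n}" "key x < key y" for x y
    using r that by (simp add: q_def)
  have "inj_on q {1..n}"
    using mono inj by (metis (no_types, lifting) inj_onD inj_onI less_irrefl linorder_neqE)
  moreover have "q ` {1..n} \<subseteq> {1..n}"
  proof
    fix y assume "y \<in> q ` {1..n}"
    then obtain x where x: "x \<in> {1..n}" "y = r x"
      by (auto simp: q_def)
    have "0 < r x"
      unfolding r_def using x(1) by (auto simp: card_gt_0_iff)
    moreover have "r x \<le> card {1..n}"
      unfolding r_def by (intro card_mono) auto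
    ultimately show "y \<in> {1..n}"
      using x by simp
  qed
  ultimately have "bij_betw q {1..n} {1..n}"
    by (simp add: bij_betw_def endo_inj_surj)
  then show "q permutes {1..n}"
    by (rule bij_imp_permutes) (auto simp: q_def)
qed

text \<open>The elements of \<open>S \<inter> T\<close> have the same order by position and by
  value, so they cut \<open>S\<close> and \<open>T\<close> into matching segments. Each segment
  after the first starts with its common element, so listing its part of \<open>S\<close> before its
  part of \<open>T - S\<close> respects both orders.\<close>

lemma amalgamate_position_value_orders:
  fixes p :: "nat \<Rightarrow> nat"
  assumes p: "p permutes {1..n}"
    and cover: "S \<union> T = {1..n}"
    and mono: "strict_mono_on (S \<inter> T) p"
  obtains key :: "nat \<Rightarrow> nat" where "inj_on key {1..n}"
    and "\<And>x y. x \<in> S \<Longrightarrow> y \<in> S \<Longrightarrow> x < y \<Longrightarrow> key x < key y"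
    and "\<And>x y. x \<in> T \<Longrightarrow> y \<in> T \<Longrightarrow> p x < p y \<Longrightarrow> key x < key y"
proof
  define A where "A = S \<inter> T"
  define f where "f x = card {a\<in>A. a \<le> x}" for x
  define g where "g x = card {a\<in>A. p a \<le> p x}" for x
  \<comment> \<open>Positions and values are below \<open>M\<close>, so modulo \<open>2 * M\<close>
    the keys on \<open>S\<close> are below \<open>M\<close> and those on \<open>T - S\<close> are at
    least \<open>M\<close>.\<close>
  define M where "M = Suc n"
  \<comment> \<open>Lexicographic: the number of elements of \<open>A\<close> up to \<open>x\<close>, then \<open>S\<close> before \<open>T - S\<close>, then
    the position or the value.\<close>
  define key where "key x = (if x \<in> S then f x * (2 * M) + x else g x * (2 * M) + (M + p x))" for x
  have less: "a * (2 * M) + u < b * (2 * M) + v" if "a < b" "u < 2 * M" for a b u v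
  proof -
    have "a * (2 * M) + u < Suc a * (2 * M)"
      using that by simp
    also have "\<dots> \<le> b * (2 * M)"
      using that by (intro mult_le_mono1) simp
    finally show ?thesis by simp
  qed
  have le_less: "a * (2 * M) + u < b * (2 * M) + v" if "a \<le> b" "u < v" for a b u v
    using that by (intro add_le_less_mono mult_le_mono1)
  have finA: "finite A"
    using cover by (metis A_def finite_Int finite_Un finite_atLeastAtMost)
  have bound: "x < M" "p x < M" if "x \<in> {1..n}" for x
    using that permutes_in_image[OF p, of x] by (auto simp: M_def)
  have inS: "x < M" if "x \<in> S" for x
    using that cover bound by blast
  have inT: "p x < M" if "x \<in> T" for x
    using that cover bound by blast
  have fg: "f a = g a" if "a \<in> A" for a
  proof -
    have "{b\<in>A. b \<le> a} = {b\<in>A. p b \<le> p a}"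
      using that mono strict_mono_on_less_eq unfolding A_def by blast
    then show ?thesis
      by (simp add: f_def g_def)
  qed
  show S: "key x < key y" if "x \<in> S" "y \<in> S" "x < y" for x y
  proof -
    have "f x \<le> f y"
      unfolding f_def using that finA by (intro card_mono) auto
    then have "f x * (2 * M) + x < f y * (2 * M) + y"
      using that(3) by (rule le_less)
    then show ?thesis
      using that by (simp only: key_def if_True)
  qed
  show T: "key x < key y" if "x \<in> T" "y \<in> T" "p x < p y" for x y
  proof -
    have le: "g x \<le> g y"
      unfolding g_def using that finA by (intro card_mono) auto
    show ?thesis
    proof (cases "y \<in> S")
      case True
      \<comment> \<open>The common element \<open>y\<close> is counted by \<open>g y\<close> but not
        by \<open>g x\<close>; this strict increase outweighs any larger second component of
        \<open>x\<close>.\<close>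
      then have "y \<in> A"
        using that by (simp add: A_def)
      then have "y \<in> {a\<in>A. p a \<le> p y} - {a\<in>A. p a \<le> p x}"
        using that by simp
      moreover have "{a\<in>A. p a \<le> p x} \<subseteq> {a\<in>A. p a \<le> p y}"
        using that by auto
      ultimately have "{a\<in>A. p a \<le> p x} \<subset> {a\<in>A. p a \<le> p y}"
        by blast
      then have "g x < g y"
        unfolding g_def using finA by (intro psubset_card_mono) simp_all
      then show ?thesis
        using that True \<open>y \<in> A\<close> inS[of x] inT[of x] fg[of x] fg[of y] less
        by (auto simp: key_def A_def)
    next
      case False
      show ?thesis
      proof (cases "x \<in> S")
        case True
        then have "f x = g x" "x < M + p y"
          using that fg inS[of x] by (auto simp: A_def)
        then show ?thesis
          using True \<open>y \<notin> S\<close> le_less[OF le] by (simp only: key_def if_True if_False)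
      next
        case False
        then show ?thesis
          using that \<open>y \<notin> S\<close> le_less[OF le] by (simp only: key_def if_False add_less_cancel_left)
      qed
    qed
  qed
  \<comment> \<open>The two monotonicity facts do not compare \<open>S\<close> with
    \<open>T - S\<close>; there the keys differ already modulo \<open>2 * M\<close>.\<close>
  have cross: "key x \<noteq> key y" if "x \<in> S" "y \<in> T" "y \<notin> S" for x y
  proof
    assume "key x = key y"
    then have "(f x * (2 * M) + x) mod (2 * M) = (g y * (2 * M) + (M + p y)) mod (2 * M)"
      using that by (simp add: key_def)
    then have "x = M + p y"
      using inS[OF that(1)] inT[OF that(2)] by simp
    then show False
      using inS[OF that(1)] by simp
  qed
  show "inj_on key {1..n}"
  proof (rule inj_onI)
    fix x y assume xy: "x \<in> {1..n}" "y \<in> {1..n}" "key x = key y"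
    consider "x \<in> S" "y \<in> S" | "x \<in> T" "y \<in> T"
      using xy cover cross by (metis Un_iff)
    then show "x = y"
    proof cases
      case 1
      then show ?thesis
        using S xy by (metis less_irrefl linorder_neqE)
    next
      case 2
      then have "p x = p y"
        using T xy by (metis less_irrefl linorder_neqE)
      then show ?thesis
        using permutes_inj[OF p] by (simp add: inj_eq)
    qed
  qed
qed

theorem theorem4p6:
  fixes k l :: nat
  assumes "k \<ge> 2" and "l \<ge> 2"
  shows "increasing_class (k + l - 1) \<subseteq> class_comp (increasing_class k) (increasing_class l)"
proof (rule subrelI)
  fix n p assume "(n, p) \<in> increasing_class (k + l - 1)"
  then obtain c where p: "p permutes {1..n}"
    and c: "c ` {1..n} \<subseteq> {..<k + l - 1}"
    and mono: "\<And>x y. \<lbrakk>x \<in> {1..n}; y \<in> {1..n}; c x = c y; x < y\<rbrakk> \<Longrightarrow> p x < p y"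
    unfolding increasing_class_iff_coloring by blast
  \<comment> \<open>Colour 0 is the distinguished subsequence; colours 1 to \<open>k - 1\<close>
    form one group, the at most \<open>l - 1\<close> colours from \<open>k\<close> on the
    other.\<close>
  define S where "S = {x\<in>{1..n}. c x < k}"
  define T where "T = {x\<in>{1..n}. c x = 0 \<or> k \<le> c x}"
  have "S \<union> T = {1..n}"
    by (auto simp: S_def T_def)
  moreover have "strict_mono_on (S \<inter> T) p"
    using mono by (auto simp: S_def T_def intro!: strict_mono_onI)
  ultimately obtain key :: "nat \<Rightarrow> nat" where key: "inj_on key {1..n}"
    and keyS: "\<And>x y. \<lbrakk>x \<in> S; y \<in> S; x < y\<rbrakk> \<Longrightarrow> key x < key y"
    and keyT: "\<And>x y. \<lbrakk>x \<in> T; y \<in> T; p x < p y\<rbrakk> \<Longrightarrow> key x < key y"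
    using amalgamate_position_value_orders[OF p] by blast
  obtain q where q: "q permutes {1..n}"
    and rank: "\<And>x y. \<lbrakk>x \<in> {1..n}; y \<in> {1..n}; key x < key y\<rbrakk> \<Longrightarrow> q x < q y"
    using rank_permutation[OF key] by blast

  have "(n, q) \<in> increasing_class l"
  proof -
    \<comment> \<open>\<open>q\<close> increases on all of \<open>S\<close>, which becomes colour 0;
      the colours from \<open>k\<close> on shift down to start at 1.\<close>
    define d where "d x = (if c x < k then 0 else c x - k + 1)" for x
    have "d ` {1..n} \<subseteq> {..<l}"
      using c assms by (force simp: d_def)
    moreover have "q x < q y" if "x \<in> {1..n}" "y \<in> {1..n}" "d x = d y" "x < y" for x y
    proof (cases "c x < k")
      case True
      then have "x \<in> S" "y \<in> S"
        using that by (auto simp: S_def d_def split: if_splits)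
      then show ?thesis
        using keyS rank that by blast
    next
      case False
      then have "c x = c y" "x \<in> T" "y \<in> T"
        using that by (auto simp: T_def d_def split: if_splits)
      then show ?thesis
        using keyT rank mono that by blast
    qed
    ultimately show ?thesis
      unfolding increasing_class_iff_coloring using q by blast
  qed

  moreover have "(n, p \<circ> inv q) \<in> increasing_class k"
  proof -
    \<comment> \<open>Here \<open>T\<close> becomes colour 0 and the other colours stay.\<close>
    define d where "d x = (if c x < k then c x else 0)" for x
    have inv: "inv q permutes {1..n}"
      using q by (rule permutes_inv)
    have "(d \<circ> inv q) ` {1..n} \<subseteq> {..<k}"
      using assms by (auto simp: d_def)
    \<comment> \<open>This is the claim at the preimages under \<open>q\<close>. Since
      \<open>rank\<close> passes only from keys to \<open>q\<close>, the argument is by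
      contradiction: a descent of \<open>p\<close> would reverse the keys.\<close>
    moreover have "p x < p y"
      if xy: "x \<in> {1..n}" "y \<in> {1..n}" "d x = d y" "q x < q y" for x y
    proof (rule ccontr)
      assume "\<not> p x < p y"
      moreover have "p x \<noteq> p y"
        using xy(4) permutes_inj[OF p] by (auto simp: inj_eq)
      ultimately have less: "p y < p x"
        by simp
      have "key y < key x"
      proof (cases "d x = 0")
        case True
        then have "x \<in> T" "y \<in> T"
          using xy by (auto simp: T_def d_def split: if_splits)
        then show ?thesis
          using keyT less by blast
      next
        case False
        then have "c x = c y" "x \<in> S" "y \<in> S"
          using xy by (auto simp: S_def d_def split: if_splits)
        \<comment> \<open>Within one colour \<open>p\<close> increases, so the order by value forces
          the order by position that \<open>keyS\<close> needs.\<close>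
        moreover from this have "y < x"
          using mono xy less by (metis less_asym linorder_neqE)
        ultimately show ?thesis
          using keyS by blast
      qed
      then show False
        using rank xy by (meson less_asym)
    qed
    then have "(p \<circ> inv q) x < (p \<circ> inv q) y"
      if "x \<in> {1..n}" "y \<in> {1..n}" "(d \<circ> inv q) x = (d \<circ> inv q) y" "x < y" for x y
      using that permutes_in_image[OF inv] by (simp add: permutes_inverses[OF q])
    ultimately show ?thesis
      unfolding increasing_class_iff_coloring using permutes_compose[OF inv p] by blast
  qed

  moreover have "p = (p \<circ> inv q) \<circ> q"
    by (simp add: fun_eq_iff permutes_inverses[OF q])
  ultimately show "(n, p) \<in> class_comp (increasing_class k) (increasing_class l)"
    unfolding class_comp_def by blast
qed

end
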